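(* Let $p$ be a prime, let $\gamma$ be a primitive element of $\mathbb{F}_{p^{2}}$, and for $i=0,1,\dots,p$ let $C_{i}=\gamma^{i}\langle\gamma^{p+1}\rangle$ be the cyclotomic classes of order $p+1$ in $\mathbb{F}_{p^{2}}$. Let $S_{i}=C_{i}\cup\{0\}$ for $i=0,1,\dots,p$. Fix $i',j'\in\{0,1,\dots,p\}$ with $i'\neq j'$. Let $m$ be a positive even integer and define $\Sigma_{l}=l+\{0,2,\dots,m-2\}\subset\mathbb{Z}_{m}$ for $l=0,1$. Then \[S_{i'j'}=(\Sigma_{0}\times S_{i'})\cup(\Sigma_{1}\times S_{j'})\] is a partial geometric difference set in the additive group $\mathbb{Z}_{m}\times\mathbb{F}_{p^{2}}$ with parameters $\left(mp^{2},\,mp;\,\left(\tfrac{m}{2}\right)^{2}p(p+3),\,\tfrac{3}{4}m^{2}p\right)$.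
   Context: Let $G$ be a finite additive Abelian group of order $v$. For $S\subseteq G$ and $z\in G$, let $\delta_{S}(z)=|\{(x,y)\in S\times S: z=x-y\}|$. Let $v>k>2$ be integers. A $k$-subset $S\subseteq G$ is a partial geometric difference set with parameters $(v,k;\alpha,\beta)$ if there are constants $\alpha,\beta$ such that for every $x\in G$, $\sum_{y\in S}\delta_{S}(x-y)=\alpha$ if $x\in S$ and $=\beta$ if $x\notin S$. *)

theory Defs
  imports "HOL-Computational_Algebra.Primes" "HOL-Algebra.Elementary_Groups" "HOL-Algebra.Multiplicative_Group"
begin

text \<open>Groups are in the multiplicative notation of HOL-Algebra: \<open>x \<otimes> inv y\<close> is the
  difference \<open>x - y\<close> of an additively written abelian group.\<close>

definition diff_count :: "('a, 'b) monoid_scheme \<Rightarrow> 'a set \<Rightarrow> 'a \<Rightarrow> nat"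
  where "diff_count G S z = card {(x, y) \<in> S \<times> S. z = x \<otimes>\<^bsub>G\<^esub> inv\<^bsub>G\<^esub> y}"

definition partial_geometric_difference_set ::
    "('a, 'b) monoid_scheme \<Rightarrow> nat \<Rightarrow> nat \<Rightarrow> nat \<Rightarrow> nat \<Rightarrow> 'a set \<Rightarrow> bool"
  where "partial_geometric_difference_set G v k \<alpha> \<beta> S \<longleftrightarrow>
    comm_group G \<and> finite (carrier G) \<and> order G = v \<and>
    v > k \<and> k > 2 \<and> S \<subseteq> carrier G \<and> card S = k \<and>
    (\<forall>x \<in> carrier G.
      (\<Sum>y\<in>S. diff_count G S (x \<otimes>\<^bsub>G\<^esub> inv\<^bsub>G\<^esub> y)) = (if x \<in> S then \<alpha> else \<beta>))"

definition primitive_element :: "('a, 'b) ring_scheme \<Rightarrow> 'a \<Rightarrow> bool"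
  where "primitive_element F \<gamma> \<longleftrightarrow>
    \<gamma> \<in> carrier (mult_of F) \<and> generate (mult_of F) {\<gamma>} = carrier (mult_of F)"

definition cyclotomic_class :: "('a, 'b) ring_scheme \<Rightarrow> nat \<Rightarrow> 'a \<Rightarrow> nat \<Rightarrow> 'a set"
  where "cyclotomic_class F e \<gamma> i =
    (\<gamma> [^]\<^bsub>mult_of F\<^esub> i) <#\<^bsub>mult_of F\<^esub> generate (mult_of F) {\<gamma> [^]\<^bsub>mult_of F\<^esub> e}"

text \<open>The translate \<open>l + {0, 2, \<dots>, m - 2}\<close> in \<open>\<int>\<^sub>m\<close>, whose elements are represented by
  the integers \<open>0, \<dots>, m - 1\<close>.\<close>

definition shifted_evens :: "nat \<Rightarrow> int \<Rightarrow> int set"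
  where "shifted_evens m l =
    l <#\<^bsub>integer_mod_group m\<^esub> {x. even x \<and> 0 \<le> x \<and> x \<le> int m - 2}"

end

theory Submission
  imports Defs "HOL-Number_Theory.Residues"
begin

text \<open>
  The sets \<open>S\<^sub>i\<close> are the \<open>p + 1\<close> lines through \<open>0\<close> of the plane \<open>F\<close> over its prime subfield: the
  nonzero elements of the prime subfield and the subgroup generated by \<open>\<gamma>\<^bsup>p+1\<^esup>\<close> both consist of the
  roots of \<open>x\<^bsup>p-1\<^esup> = 1\<close>. So two distinct \<open>S\<^sub>i\<close>, \<open>S\<^sub>j\<close> are complementary additive subgroups of order \<open>p\<close>.

  With \<open>E\<close> the even residues, \<open>K = E \<times> S\<^sub>i\<close>, \<open>L = E \<times> S\<^sub>j\<close> and \<open>c = (1, 0)\<close>, the set in question is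
  \<open>S = K \<union> (c + L)\<close>, where \<open>M = K + L\<close> has index two and does not contain \<open>c\<close>. Hence
  \<open>\<delta>\<^sub>S(z) = |K| ([z \<in> K] + [z \<in> L])\<close> on \<open>M\<close> and \<open>\<delta>\<^sub>S(z) = 2 |K \<inter> L|\<close> off \<open>M\<close>, and summing over \<open>x - S\<close> gives
  \<open>|K|\<^sup>2 [x \<in> S] + 3 |K \<inter> L| |K|\<close>.
\<close>

section \<open>Counting with translates, products and differences in a group\<close>

lemma (in group) card_right_translate_into_subgroup:
  assumes "subgroup K G" "subgroup L G" "x \<in> carrier G"
  shows "card {y \<in> K. x \<otimes> inv y \<in> L} = (if x \<in> L <#> K then card (L \<inter> K) else 0)"
proof -
  interpret K: subgroup K G by fact
  interpret L: subgroup L G by fact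
  have "card {y \<in> K. x \<otimes> inv y \<in> L} = card (L \<inter> K)" if xLK: "x \<in> L <#> K"
  proof -
    obtain l k where lk: "l \<in> L" "k \<in> K" "x = l \<otimes> k"
      using xLK by (auto simp: set_mult_def)
    have [simp]: "l \<in> carrier G" "k \<in> carrier G"
      using lk by auto
    \<comment> \<open>As \<open>x = l \<otimes> k\<close>, the condition
      \<open>x \<otimes> inv y \<in> L\<close> amounts to \<open>k \<otimes> inv y \<in> L\<close>,
      so the solutions form the coset of \<open>L \<inter> K\<close> through
      \<open>k\<close>.\<close>
    have "bij_betw (\<lambda>h. h \<otimes> k) (L \<inter> K) {y \<in> K. x \<otimes> inv y \<in> L}"
    proof (rule bij_betw_byWitness[where f' = "\<lambda>y. y \<otimes> inv k"])
      show "\<forall>h \<in> L \<inter> K. h \<otimes> k \<otimes> inv k = h"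
        by (auto simp: m_assoc)
      show "\<forall>y \<in> {y \<in> K. x \<otimes> inv y \<in> L}. y \<otimes> inv k \<otimes> k = y"
        by (auto simp: m_assoc)
      show "(\<lambda>h. h \<otimes> k) ` (L \<inter> K) \<subseteq> {y \<in> K. x \<otimes> inv y \<in> L}"
      proof (rule image_subsetI)
        fix h assume "h \<in> L \<inter> K"
        then have h: "h \<in> L" "h \<in> K" by auto
        have "x \<otimes> inv (h \<otimes> k) = l \<otimes> inv h"
          using h lk by (simp add: inv_mult_group m_assoc[symmetric]) (simp add: m_assoc)
        then show "h \<otimes> k \<in> {y \<in> K. x \<otimes> inv y \<in> L}"
          using h lk by auto
      qed
      show "(\<lambda>y. y \<otimes> inv k) ` {y \<in> K. x \<otimes> inv y \<in> L} \<subseteq> L \<inter> K"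
      proof (rule image_subsetI)
        fix y assume "y \<in> {y \<in> K. x \<otimes> inv y \<in> L}"
        then have y: "y \<in> K" "x \<otimes> inv y \<in> L" by auto
        have "y \<otimes> inv k = inv (x \<otimes> inv y) \<otimes> l"
          using y lk by (simp add: inv_mult_group m_assoc)
        moreover have "\<dots> \<in> L"
          using y lk by blast
        ultimately have "y \<otimes> inv k \<in> L"
          by simp
        moreover have "y \<otimes> inv k \<in> K"
          using y lk by blast
        ultimately show "y \<otimes> inv k \<in> L \<inter> K" ..
      qed
    qed
    then show ?thesis
      by (simp add: bij_betw_same_card)
  qed
  moreover have "{y \<in> K. x \<otimes> inv y \<in> L} = {}" if "x \<notin> L <#> K"
  proof -
    have "x \<in> L <#> K" if "y \<in> K" "x \<otimes> inv y \<in> L" for y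
    proof -
      have "x = x \<otimes> inv y \<otimes> y"
        using that assms by (simp add: m_assoc)
      then show ?thesis
        using that unfolding set_mult_def by blast
    qed
    with that show ?thesis by blast
  qed
  ultimately show ?thesis
    by (metis card.empty)
qed

lemma (in group) card_left_translate_into_subgroup:
  assumes "subgroup K G" "subgroup L G" "x \<in> carrier G"
  shows "card {y \<in> K. x \<otimes> y \<in> L} = (if x \<in> L <#> K then card (L \<inter> K) else 0)"
proof -
  interpret K: subgroup K G by fact
  have "bij_betw (m_inv G) {y \<in> K. x \<otimes> y \<in> L} {y \<in> K. x \<otimes> inv y \<in> L}"
    by (rule bij_betw_byWitness[where f' = "m_inv G"]) auto
  then show ?thesis
    using card_right_translate_into_subgroup[OF assms] by (simp add: bij_betw_same_card)
qed

lemma (in group) set_mult_subgroup_self: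
  assumes "subgroup K G"
  shows "K <#> K = K"
proof -
  interpret K: subgroup K G by fact
  have "x \<in> K <#> K" if "x \<in> K" for x
    unfolding set_mult_def using that r_one[of x] K.one_closed K.mem_carrier[of x] by fastforce
  then show ?thesis
    by (auto simp: set_mult_def)
qed

text \<open>The second entry \<open>b\<close> of a pair with difference \<open>z\<close> determines
  the first as \<open>z \<otimes> b\<close>.\<close>

lemma (in group) diff_count_eq:
  assumes "S \<subseteq> carrier G" "z \<in> carrier G"
  shows "diff_count G S z = card {b \<in> S. z \<otimes> b \<in> S}"
proof -
  have "bij_betw snd {(x, y) \<in> S \<times> S. z = x \<otimes> inv y} {b \<in> S. z \<otimes> b \<in> S}"
    by (rule bij_betw_byWitness[where f' = "\<lambda>b. (z \<otimes> b, b)"])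
      (use assms in \<open>auto simp: m_assoc subset_iff\<close>)
  then show ?thesis
    by (simp add: diff_count_def bij_betw_same_card)
qed

text \<open>If \<open>h \<otimes> k = h' \<otimes> k'\<close>, then
  \<open>inv h' \<otimes> h = k' \<otimes> inv k\<close> lies in both subgroups, hence is
  \<open>\<one>\<close>. So all products are distinct and exhaust the group by counting.\<close>

lemma (in group) set_mult_eq_carrier:
  assumes "finite (carrier G)" "subgroup H G" "subgroup K G"
    and "H \<inter> K = {\<one>}" "card H * card K = order G"
  shows "H <#> K = carrier G"
proof (rule card_subset_eq)
  interpret H: subgroup H G by fact
  interpret K: subgroup K G by fact
  have "inj_on (\<lambda>(h, k). h \<otimes> k) (H \<times> K)"
  proof (rule inj_onI, clarify)
    fix h k h' k' assume *: "h \<in> H" "k \<in> K" "h' \<in> H" "k' \<in> K" "h \<otimes> k = h' \<otimes> k'"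
    have "inv h' \<otimes> h = inv h' \<otimes> (h \<otimes> k) \<otimes> inv k"
      using *(1-4) by (simp add: m_assoc)
    also have "\<dots> = k' \<otimes> inv k"
      using * by (simp add: m_assoc[symmetric])
    finally have eq: "inv h' \<otimes> h = k' \<otimes> inv k" .
    have "inv h' \<otimes> h \<in> H" "k' \<otimes> inv k \<in> K"
      using * by auto
    then have "inv h' \<otimes> h = \<one>"
      using eq assms(4) by auto
    moreover have "h = h' \<otimes> (inv h' \<otimes> h)"
      using *(1,3) by (simp add: m_assoc[symmetric])
    ultimately have "h = h'"
      using * by simp
    with * show "h = h' \<and> k = k'" by auto
  qed
  moreover have "H <#> K = (\<lambda>(h, k). h \<otimes> k) ` (H \<times> K)"
    by (auto simp: set_mult_def)
  ultimately show "card (H <#> K) = card (carrier G)"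
    using assms(5) by (simp add: card_image card_cartesian_product order_def)
  show "H <#> K \<subseteq> carrier G"
    by (rule set_mult_closed[OF H.subset K.subset])
qed fact

section \<open>The difference set built from two subgroups whose product has index two\<close>

text \<open>Index two is encoded by \<open>mult_mem_iff\<close>: membership in
  \<open>K <#> L\<close> behaves like a homomorphism to the group of order two. In this form,
  membership of products is decided by rewriting.\<close>

locale subgroup_pair_index_two = comm_group G for G (structure) +
  fixes K L :: "'a set" and c :: 'a
  assumes finite_carrier: "finite (carrier G)"
    and subgroup_K: "subgroup K G" and subgroup_L: "subgroup L G"
    and card_L: "card L = card K"
    and c_carrier: "c \<in> carrier G" and c_notin: "c \<notin> K <#> L"
    and mult_mem_iff: "\<And>x y. x \<in> carrier G \<Longrightarrow> y \<in> carrier G \<Longrightarrow>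
      x \<otimes> y \<in> K <#> L \<longleftrightarrow> (x \<in> K <#> L \<longleftrightarrow> y \<in> K <#> L)"
begin

sublocale K: subgroup K G by (fact subgroup_K)
sublocale L: subgroup L G by (fact subgroup_L)

declare c_carrier [simp]

abbreviation "M \<equiv> K <#> L"
abbreviation "S \<equiv> K \<union> (c <# L)"

lemma K_subset_M: "K \<subseteq> M"
proof
  fix x assume "x \<in> K"
  then have "x \<otimes> \<one> \<in> M"
    unfolding set_mult_def by (intro UN_I[of x] UN_I[of \<one>]) simp_all
  then show "x \<in> M"
    using \<open>x \<in> K\<close> by simp
qed

lemma L_subset_M: "L \<subseteq> M"
proof
  fix x assume "x \<in> L"
  then have "\<one> \<otimes> x \<in> M"
    unfolding set_mult_def by (intro UN_I[of x] UN_I[of \<one>]) simp_all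
  then show "x \<in> M"
    using \<open>x \<in> L\<close> by simp
qed

lemma L_mult_K: "L <#> K = M"
  by (rule commut_normal[OF subgroup_L subgroup_imp_normal[OF subgroup_K]])

lemma S_carrier: "S \<subseteq> carrier G"
  using K.subset l_coset_subset_G[OF L.subset c_carrier] by simp

lemma finite_S: "finite S"
  by (rule finite_subset[OF S_carrier finite_carrier])

lemma mem_lcoset_iff: "w \<in> carrier G \<Longrightarrow> w \<in> c <# L \<longleftrightarrow> inv c \<otimes> w \<in> L"
  using L.lcos_module_rev[of c w] by (auto simp: l_coset_def m_assoc[symmetric])

lemma inv_mem_iff: "x \<in> carrier G \<Longrightarrow> inv x \<in> M \<longleftrightarrow> x \<in> M"
  using mult_mem_iff[of x "inv x"] subsetD[OF K_subset_M K.one_closed] by simp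

lemma lcoset_notin_M: "y \<in> c <# L \<Longrightarrow> y \<notin> M"
  using L_subset_M c_notin by (auto simp: l_coset_def mult_mem_iff)

text \<open>\<open>K\<close> lies inside \<open>M\<close> and \<open>c <# L\<close> outside it, so
  the two halves are disjoint; translation by \<open>c\<close> is injective on
  \<open>L\<close>.\<close>

lemma sum_S: "sum f S = (\<Sum>y\<in>K. f y) + (\<Sum>l\<in>L. f (c \<otimes> l))"
proof -
  have "sum f S = sum f K + sum f (c <# L)"
    using K_subset_M lcoset_notin_M finite_S by (intro sum.union_disjoint) auto
  also have "sum f (c <# L) = sum f ((\<lambda>l. c \<otimes> l) ` L)"
    by (rule arg_cong[where f = "sum f"]) (auto simp: l_coset_def)
  also have "\<dots> = (\<Sum>l\<in>L. f (c \<otimes> l))"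
    by (subst sum.reindex) (auto simp: inj_on_def)
  finally show ?thesis .
qed

lemma card_S: "card S = 2 * card K"
  using sum_S[of "\<lambda>_. 1 :: nat"] card_L by simp

lemma card_Collect_S: "card {b \<in> S. P b} = card {b \<in> K. P b} + card {l \<in> L. P (c \<otimes> l)}"
proof -
  have "finite K" "finite L"
    using finite_subset[OF K.subset finite_carrier] finite_subset[OF L.subset finite_carrier] .
  then have eq: "card {b \<in> A. Q b} = (\<Sum>b\<in>A. if Q b then 1 else 0)" if "A \<in> {S, K, L}" for A Q
    using that finite_S by (subst sum.If_cases) (auto simp: Int_def)
  have "card {b \<in> S. P b} = (\<Sum>b\<in>S. if P b then 1 else 0)"
    by (rule eq) simp
  then show ?thesis
    by (simp add: eq sum_S)
qed

text \<open>Translation by \<open>z \<in> M\<close> preserves the two sides of \<open>M\<close>, so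
  each half of \<open>S\<close> can only meet itself. Translation by \<open>z \<notin> M\<close>
  swaps the sides, so each half can only meet the other.\<close>

lemma diff_count_S:
  assumes z: "z \<in> carrier G"
  shows "diff_count G S z =
    (if z \<in> M then (if z \<in> K then card K else 0) + (if z \<in> L then card K else 0)
     else 2 * card (K \<inter> L))"
proof -
  have cz: "z \<otimes> (c \<otimes> l) \<in> c <# L \<longleftrightarrow> z \<otimes> l \<in> L" if "l \<in> L" for l
  proof -
    have "inv c \<otimes> (z \<otimes> (c \<otimes> l)) = inv c \<otimes> (c \<otimes> (z \<otimes> l))"
      using that z by (simp add: m_lcomm)
    also have "\<dots> = z \<otimes> l"
      using that z by (simp add: m_assoc[symmetric])
    finally show ?thesis
      using that z by (simp add: mem_lcoset_iff)
  qed
  have *: "diff_count G S z = card {b \<in> K. z \<otimes> b \<in> S} + card {l \<in> L. z \<otimes> (c \<otimes> l) \<in> S}"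
    using S_carrier z by (simp only: diff_count_eq card_Collect_S)
  show ?thesis
  proof (cases "z \<in> M")
    case True
    have "z \<otimes> b \<notin> c <# L" if "b \<in> K" for b
      using lcoset_notin_M[of "z \<otimes> b"] True that K_subset_M z by (auto simp: mult_mem_iff)
    then have "{b \<in> K. z \<otimes> b \<in> S} = {b \<in> K. z \<otimes> b \<in> K}"
      by auto
    moreover have "z \<otimes> (c \<otimes> l) \<notin> K" if "l \<in> L" for l
    proof -
      have "z \<otimes> (c \<otimes> l) \<notin> M"
        using that c_notin True L_subset_M z by (auto simp: mult_mem_iff)
      then show ?thesis
        using K_subset_M by blast
    qed
    then have "{l \<in> L. z \<otimes> (c \<otimes> l) \<in> S} = {l \<in> L. z \<otimes> l \<in> L}"
      using cz by auto
    ultimately show ?thesis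
      using True z * card_L
      by (simp add: card_left_translate_into_subgroup subgroup_K subgroup_L set_mult_subgroup_self)
  next
    case False
    have "z \<otimes> b \<notin> K" if "b \<in> K" for b
    proof -
      have "z \<otimes> b \<notin> M"
        using that False K_subset_M z by (auto simp: mult_mem_iff)
      then show ?thesis
        using K_subset_M by blast
    qed
    then have "{b \<in> K. z \<otimes> b \<in> S} = {b \<in> K. (inv c \<otimes> z) \<otimes> b \<in> L}"
      using z by (auto simp: mem_lcoset_iff m_assoc)
    moreover have "z \<otimes> l \<notin> L" if "l \<in> L" for l
    proof -
      have "z \<otimes> l \<notin> M"
        using that False L_subset_M z by (auto simp: mult_mem_iff)
      then show ?thesis
        using L_subset_M by blast
    qed
    then have "{l \<in> L. z \<otimes> (c \<otimes> l) \<in> S} = {l \<in> L. (z \<otimes> c) \<otimes> l \<in> K}"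
      using z cz by (auto simp: m_assoc)
    \<comment> \<open>Both \<open>z\<close> and \<open>c\<close> lie off \<open>M\<close>, so these
      products lie in it. Hence neither of the two counts vanishes, and each equals
      \<open>card (K \<inter> L)\<close>.\<close>
    moreover have "inv c \<otimes> z \<in> M" "z \<otimes> c \<in> M"
      using False c_notin z by (auto simp: mult_mem_iff inv_mem_iff)
    ultimately show ?thesis
      using False z *
      by (simp add: card_left_translate_into_subgroup subgroup_K subgroup_L L_mult_K Int_commute)
  qed
qed

text \<open>For \<open>A = B\<close> this detects membership of \<open>x\<close> in
  \<open>A\<close>; for \<open>A\<close> and \<open>B\<close> being \<open>K\<close> and
  \<open>L\<close> in either order it is the same constant at every
  \<open>x \<in> M\<close>.\<close>

lemma sum_indicator_eq:
  assumes "subgroup A G" "subgroup B G" "x \<in> carrier G"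
  shows "(\<Sum>y\<in>A. if x \<otimes> inv y \<in> B then card K else 0) =
    (if x \<in> B <#> A then card (B \<inter> A) * card K else 0)"
proof -
  have "finite A"
    by (rule finite_subset[OF subgroup.subset[OF assms(1)] finite_carrier])
  then have "(\<Sum>y\<in>A. if x \<otimes> inv y \<in> B then card K else 0) = card {y \<in> A. x \<otimes> inv y \<in> B} * card K"
    by (subst sum.If_cases) (auto simp: Int_def)
  then show ?thesis
    by (simp add: card_right_translate_into_subgroup[OF assms])
qed

text \<open>The half of \<open>S\<close> on the same side of \<open>M\<close> as \<open>x\<close>
  contributes the square, if \<open>x \<in> S\<close>, and one copy of
  \<open>card (K \<inter> L) * card K\<close>. The other half has all its differences off
  \<open>M\<close> and contributes two more copies.\<close>

lemma sum_diff_count_S: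
  assumes x: "x \<in> carrier G"
  shows "(\<Sum>y\<in>S. diff_count G S (x \<otimes> inv y)) =
    (if x \<in> S then (card K)\<^sup>2 else 0) + 3 * card (K \<inter> L) * card K"
proof (cases "x \<in> M")
  case True
  have "diff_count G S (x \<otimes> inv y) = (if x \<otimes> inv y \<in> K then card K else 0) +
    (if x \<otimes> inv y \<in> L then card K else 0)" if "y \<in> K" for y
  proof -
    have "x \<otimes> inv y \<in> M"
      using True that K_subset_M x by (auto simp: mult_mem_iff inv_mem_iff)
    then show ?thesis
      using that x by (simp add: diff_count_S)
  qed
  moreover have "diff_count G S (x \<otimes> inv (c \<otimes> l)) = 2 * card (K \<inter> L)" if "l \<in> L" for l
  proof -
    have "x \<otimes> inv (c \<otimes> l) \<notin> M"
      using True that L_subset_M c_notin x by (auto simp: mult_mem_iff inv_mem_iff)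
    then show ?thesis
      using that x by (simp add: diff_count_S)
  qed
  moreover have "x \<in> S \<longleftrightarrow> x \<in> K"
    using True lcoset_notin_M by auto
  ultimately show ?thesis
    using True x
    by (simp add: sum_S sum.distrib sum_indicator_eq subgroup_K subgroup_L set_mult_subgroup_self
        L_mult_K card_L Int_commute power2_eq_square)
next
  case False
  \<comment> \<open>Dividing by \<open>c\<close> brings \<open>x\<close> into \<open>M\<close> and
    \<open>c <# L\<close> to \<open>L\<close>, so the first case recurs with \<open>K\<close> and
    \<open>L\<close> exchanged.\<close>
  define x' where "x' = inv c \<otimes> x"
  have x': "x' \<in> carrier G" "x' \<in> M"
    using x False c_notin by (auto simp: x'_def mult_mem_iff inv_mem_iff)
  have "diff_count G S (x \<otimes> inv y) = 2 * card (K \<inter> L)" if "y \<in> K" for y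
  proof -
    have "x \<otimes> inv y \<notin> M"
      using False that K_subset_M x by (auto simp: mult_mem_iff inv_mem_iff)
    then show ?thesis
      using that x by (simp add: diff_count_S)
  qed
  moreover have "diff_count G S (x \<otimes> inv (c \<otimes> l)) = (if x' \<otimes> inv l \<in> K then card K else 0) +
    (if x' \<otimes> inv l \<in> L then card K else 0)" if "l \<in> L" for l
  proof -
    have "x \<otimes> inv (c \<otimes> l) = x' \<otimes> inv l"
      using x that by (simp add: x'_def inv_mult m_ac)
    moreover have "x' \<otimes> inv l \<in> M"
      using x' that L_subset_M by (auto simp: mult_mem_iff inv_mem_iff)
    ultimately show ?thesis
      using that x' by (simp add: diff_count_S)
  qed
  moreover have "x \<in> S \<longleftrightarrow> x' \<in> L"
    using False K_subset_M x by (auto simp: mem_lcoset_iff x'_def)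
  ultimately show ?thesis
    using x x'
    by (simp add: sum_S sum.distrib sum_indicator_eq subgroup_K subgroup_L set_mult_subgroup_self
        L_mult_K card_L power2_eq_square)
qed

end

section \<open>The lines through zero in a field of order \<open>p\<^sup>2\<close>\<close>

locale field_of_prime_square_order = field R for R (structure) +
  fixes p :: nat and \<gamma> :: 'a
  assumes prime_p: "prime p" and order_R: "order R = p\<^sup>2"
    and primitive: "primitive_element R \<gamma>"
begin

sublocale mult: group "mult_of R"
  by (rule field_mult_group)

abbreviation prime_subfield :: "'a set"
  where "prime_subfield \<equiv> generate (add_monoid R) {\<one>}"

lemma finite_carrier: "finite (carrier R)"
  using prime_p order_R by (metis order_gt_0_iff_finite prime_gt_0_nat zero_less_power)

text \<open>The square of \<open>[p] \<cdot> \<one>\<close> is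
  \<open>[p * p] \<cdot> \<one>\<close>, which vanishes because the additive group has order
  \<open>p * p\<close>; a field has no zero divisors.\<close>

lemma p_times_one: "[p] \<cdot> \<one> = \<zero>"
proof -
  have "[p] \<cdot> \<one> \<otimes> [p] \<cdot> \<one> = [(p * p)] \<cdot> \<one>"
    by (simp add: add_pow_ldistr add.nat_pow_pow mult.commute)
  also have "\<dots> = \<zero>"
    using add.pow_order_eq_1[of \<one>] order_R by (simp add: order_def power2_eq_square)
  finally show ?thesis
    by (meson add.nat_pow_closed integral one_closed)
qed

lemma ord_one: "add.ord \<one> = p"
proof -
  have "add.ord \<one> dvd p"
    using p_times_one by (simp add: add.pow_eq_id[symmetric])
  moreover have "add.ord \<one> \<noteq> 1"
    using add.ord_eq_1[of \<one>] by auto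
  ultimately show ?thesis
    using prime_p unfolding prime_nat_iff by blast
qed

lemma card_prime_subfield: "card prime_subfield = p"
  using add.generate_pow_card[of \<one>] ord_one by simp

lemma subgroup_prime_subfield: "subgroup prime_subfield (add_monoid R)"
  using add.generate_is_subgroup[of "{\<one>}"] by simp

lemma prime_subfield_eq: "prime_subfield = range (\<lambda>n :: nat. [n] \<cdot> \<one>)"
  using add.generate_pow_on_finite_carrier[of \<one>] finite_carrier by auto

lemma nat_multiple_one_pow: "([n] \<cdot> \<one>) [^] (k :: nat) = [(n ^ k)] \<cdot> \<one>" for n :: nat
  by (induction k) (simp_all add: add_pow_rdistr add.nat_pow_pow mult.commute)

text \<open>Fermat's little theorem for \<open>n\<close>, carried over to
  \<open>[n] \<cdot> \<one>\<close>, whose value depends only on \<open>n\<close> modulo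
  \<open>p\<close>.\<close>

lemma prime_subfield_pow:
  assumes "x \<in> prime_subfield" "x \<noteq> \<zero>"
  shows "x [^] (p - 1) = \<one>"
proof -
  obtain n :: nat where n: "x = [n] \<cdot> \<one>"
    using assms(1) by (auto simp: prime_subfield_eq)
  have "\<not> p dvd n"
    using assms(2) ord_one add.pow_eq_id[of \<one> n] by (simp add: n)
  then have "[n ^ (p - 1) = 1] (mod p)"
    by (rule fermat_theorem[OF prime_p])
  then have "[int 1 = int (n ^ (p - 1))] (mod int p)"
    by (metis cong_int_iff cong_sym)
  then have "[int (n ^ (p - 1))] \<cdot> \<one> = [int 1] \<cdot> \<one>"
    using add.int_pow_eq[of \<one> "int (n ^ (p - 1))" "int 1"] ord_one
    by (simp add: cong_iff_dvd_diff)
  then show ?thesis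
    by (simp add: n nat_multiple_one_pow add_pow_int_ge del: of_nat_power)
qed

lemma gamma_closed: "\<gamma> \<in> carrier (mult_of R)"
  using primitive by (simp add: primitive_element_def)

lemma ord_gamma: "mult.ord \<gamma> = (p + 1) * (p - 1)"
proof -
  have "mult.ord \<gamma> = order (mult_of R)"
    using mult.generate_pow_card[OF gamma_closed] primitive
    by (simp add: primitive_element_def order_def)
  also have "\<dots> = p\<^sup>2 - 1"
    using order_mult_of[OF finite_carrier] order_R by simp
  also have "\<dots> = (p + 1) * (p - 1)"
    by (simp add: power2_eq_square algebra_simps)
  finally show ?thesis .
qed

definition H :: "'a set"
  where "H = generate (mult_of R) {\<gamma> [^]\<^bsub>mult_of R\<^esub> (p + 1)}"

lemma subgroup_H: "subgroup H (mult_of R)"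
  using mult.generate_is_subgroup[of "{\<gamma> [^]\<^bsub>mult_of R\<^esub> (p + 1)}"]
    mult.nat_pow_closed[OF gamma_closed] unfolding H_def by blast

lemma ord_gamma_pow: "mult.ord (\<gamma> [^]\<^bsub>mult_of R\<^esub> (p + 1)) = p - 1"
proof -
  have "p + 1 dvd mult.ord \<gamma>"
    unfolding ord_gamma by (rule dvd_triv_left)
  then have "mult.ord (\<gamma> [^]\<^bsub>mult_of R\<^esub> (p + 1)) = mult.ord \<gamma> div (p + 1)"
    by (rule mult.ord_pow[OF gamma_closed]) simp
  then show ?thesis
    unfolding ord_gamma by (metis add_is_0 nonzero_mult_div_cancel_left one_neq_zero)
qed

lemma card_H: "card H = p - 1"
  using mult.generate_pow_card[OF mult.nat_pow_closed[OF gamma_closed]] ord_gamma_pow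
  unfolding H_def by metis

text \<open>Every element of a group of order \<open>p - 1\<close> is such a root, and a field has
  at most \<open>p - 1\<close> roots of \<open>x [^] (p - 1) = \<one>\<close>.\<close>

lemma H_eq: "H = {x \<in> carrier R. x [^] (p - 1) = \<one>}"
proof (rule card_seteq)
  show "finite {x \<in> carrier R. x [^] (p - 1) = \<one>}"
    using finite_carrier by simp
  show "card {x \<in> carrier R. x [^] (p - 1) = \<one>} \<le> card H"
    using card_H num_roots_le_deg[OF finite_carrier, of "p - 1"] prime_gt_1_nat[OF prime_p] by simp
  show "H \<subseteq> {x \<in> carrier R. x [^] (p - 1) = \<one>}"
  proof
    fix x assume x: "x \<in> H"
    interpret H: group "mult_of R\<lparr>carrier := H\<rparr>"
      using subgroup.subgroup_is_group[OF subgroup_H mult.is_group] .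
    have "x [^]\<^bsub>mult_of R\<lparr>carrier := H\<rparr>\<^esub> (p - 1) = \<one>"
      using H.pow_order_eq_1[of x] x card_H by (simp add: order_def)
    then have "x [^] (p - 1) = \<one>"
      by (simp add: nat_pow_mult_of[symmetric] nat_pow_def)
    moreover have "x \<in> carrier R"
      using subgroup.mem_carrier[OF subgroup_H x] by simp
    ultimately show "x \<in> {x \<in> carrier R. x [^] (p - 1) = \<one>}" by simp
  qed
qed

text \<open>Fermat gives one inclusion and both sides have \<open>p\<close> elements. This is the
  source of additive closure for the multiplicatively defined classes.\<close>

lemma prime_subfield_eq_insert_H: "prime_subfield = insert \<zero> H"
proof (rule card_seteq)
  have "H \<subseteq> carrier R"
    using subgroup.subset[OF subgroup_H] by auto
  then have "finite H"
    using finite_carrier finite_subset by blast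
  then show "finite (insert \<zero> H)"
    by simp
  show "prime_subfield \<subseteq> insert \<zero> H"
    using prime_subfield_pow subgroup.subset[OF subgroup_prime_subfield] by (auto simp: H_eq)
  have "card (insert \<zero> H) \<le> Suc (card H)"
    by (rule card_insert_le_m1) auto
  also have "\<dots> = p"
    using card_H prime_gt_1_nat[OF prime_p] by simp
  finally show "card (insert \<zero> H) \<le> card prime_subfield"
    by (simp add: card_prime_subfield)
qed

definition line :: "nat \<Rightarrow> 'a set"
  where "line i = cyclotomic_class R (p + 1) \<gamma> i \<union> {\<zero>}"

lemma gamma_pow: "\<gamma> [^]\<^bsub>mult_of R\<^esub> (i :: nat) = \<gamma> [^] i"
  by (simp add: nat_pow_mult_of)

lemma gamma_pow_closed: "\<gamma> [^] (i :: nat) \<in> carrier R" "\<gamma> [^] (i :: nat) \<noteq> \<zero>"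
  using mult.nat_pow_closed[OF gamma_closed, of i] by (simp_all add: gamma_pow)

lemma line_eq: "line i = (\<lambda>x. \<gamma> [^] i \<otimes> x) ` prime_subfield"
  unfolding line_def cyclotomic_class_def H_def[symmetric]
  by (auto simp: l_coset_def prime_subfield_eq_insert_H gamma_pow gamma_pow_closed)

text \<open>Multiplication by \<open>\<gamma> [^] i\<close> is an additive endomorphism, and the
  line is its image of the prime subfield.\<close>

lemma subgroup_line: "subgroup (line i) (add_monoid R)"
proof -
  interpret group_hom "add_monoid R" "add_monoid R" "\<lambda>x. \<gamma> [^] i \<otimes> x"
    by unfold_locales (auto simp: hom_def r_distr gamma_pow_closed)
  show ?thesis
    unfolding line_eq by (rule subgroup_img_is_subgroup[OF subgroup_prime_subfield])
qed

lemma card_line: "card (line i) = p"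
proof -
  have "inj_on (\<lambda>x. \<gamma> [^] i \<otimes> x) (carrier R)"
    by (auto simp: inj_on_def m_lcancel gamma_pow_closed)
  then have "inj_on (\<lambda>x. \<gamma> [^] i \<otimes> x) prime_subfield"
    using subgroup.subset[OF subgroup_prime_subfield] by (auto intro: inj_on_subset)
  then show ?thesis
    by (simp add: line_eq card_image card_prime_subfield)
qed

text \<open>The power \<open>p - 1\<close> kills the factor from \<open>H\<close>, leaving a value
  that depends only on the class; it serves to tell lines apart.\<close>

lemma line_pow:
  assumes "y \<in> line i" "y \<noteq> \<zero>"
  shows "y [^] (p - 1) = \<gamma> [^] (i * (p - 1))"
proof -
  obtain u where u: "u \<in> H" "y = \<gamma> [^] i \<otimes> u"
    using assms unfolding line_def cyclotomic_class_def H_def[symmetric]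
    by (auto simp: l_coset_def gamma_pow)
  have "u \<in> carrier R" "u [^] (p - 1) = \<one>"
    using u(1) by (auto simp: H_eq)
  then show ?thesis
    using gamma_closed by (simp add: u(2) nat_pow_distrib gamma_pow_closed nat_pow_pow)
qed

lemma line_Int:
  assumes "i \<le> p" "j \<le> p" "i \<noteq> j"
  shows "line i \<inter> line j = {\<zero>}"
proof -
  have "y = \<zero>" if y: "y \<in> line i" "y \<in> line j" for y
  proof (rule ccontr)
    assume "y \<noteq> \<zero>"
    then have eq: "\<gamma> [^]\<^bsub>mult_of R\<^esub> (i * (p - 1)) = \<gamma> [^]\<^bsub>mult_of R\<^esub> (j * (p - 1))"
      using line_pow y by (metis gamma_pow)
    have "p - 1 > 0"
      using prime_gt_1_nat[OF prime_p] by simp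
    \<comment> \<open>For indices up to \<open>p\<close> the exponents stay below the order
      \<open>(p + 1) * (p - 1)\<close> of \<open>\<gamma>\<close>, where powers of
      \<open>\<gamma>\<close> are distinct.\<close>
    then have "l * (p - 1) \<in> {0..mult.ord \<gamma> - 1}" if "l \<le> p" for l
    proof -
      have "l * (p - 1) < mult.ord \<gamma>"
        unfolding ord_gamma using that \<open>p - 1 > 0\<close> by (intro mult_strict_right_mono) auto
      then show ?thesis by simp
    qed
    then have "i * (p - 1) = j * (p - 1)"
      using mult.ord_inj[OF gamma_closed] eq assms by (auto dest!: inj_onD)
    then show False
      using \<open>p - 1 > 0\<close> assms by simp
  qed
  then show ?thesis
    by (auto simp: line_def)
qed

lemma line_add_line:
  assumes "i \<le> p" "j \<le> p" "i \<noteq> j"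
  shows "line i <#>\<^bsub>add_monoid R\<^esub> line j = carrier R"
  using add.set_mult_eq_carrier[OF _ subgroup_line subgroup_line] line_Int[OF assms] finite_carrier
    order_R by (simp add: card_line order_def power2_eq_square)

end

section \<open>Direct products and the even residues\<close>

lemma set_mult_DirProd: "(A \<times> B) <#>\<^bsub>G \<times>\<times> H\<^esub> (C \<times> D) = (A <#>\<^bsub>G\<^esub> C) \<times> (B <#>\<^bsub>H\<^esub> D)"
  by (force simp: set_mult_def)

lemma l_coset_DirProd: "(a, b) <#\<^bsub>G \<times>\<times> H\<^esub> (C \<times> D) = (a <#\<^bsub>G\<^esub> C) \<times> (b <#\<^bsub>H\<^esub> D)"
  by (force simp: l_coset_def)

lemma comm_group_DirProd:
  assumes "comm_group G" "comm_group H"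
  shows "comm_group (G \<times>\<times> H)"
proof (rule group.group_comm_groupI)
  show "group (G \<times>\<times> H)"
    using assms by (simp add: DirProd_group comm_group.axioms)
qed (use assms in \<open>auto simp: comm_group_def comm_monoid.m_comm\<close>)

lemma shifted_evens_0:
  assumes "m > 0" "even m"
  shows "shifted_evens m 0 = {x \<in> {0..<int m}. even x}"
proof -
  have "shifted_evens m 0 = (\<lambda>x. x mod int m) ` {x. even x \<and> 0 \<le> x \<and> x \<le> int m - 2}"
    using assms by (auto simp: shifted_evens_def l_coset_def)
  also have "\<dots> = {x. even x \<and> 0 \<le> x \<and> x \<le> int m - 2}"
    by (force simp: image_iff)
  also have "\<dots> = {x \<in> {0..<int m}. even x}"
  proof -
    \<comment> \<open>As \<open>m\<close> is even, an even \<open>x < m\<close> cannot equal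
      \<open>m - 1\<close>.\<close>
    have "x \<le> int m - 2" if "even x" "x < int m" for x
      using that assms by presburger
    then show ?thesis by auto
  qed
  finally show ?thesis .
qed

lemma shifted_evens_1:
  assumes "m > 0" "even m"
  shows "shifted_evens m 1 = 1 <#\<^bsub>integer_mod_group m\<^esub> shifted_evens m 0"
proof -
  have "{x. even x \<and> 0 \<le> x \<and> x \<le> int m - 2} = shifted_evens m 0"
    unfolding shifted_evens_0[OF assms] using assms by (auto; presburger)
  then show ?thesis
    by (simp add: shifted_evens_def)
qed

lemma card_shifted_evens_0:
  assumes "m > 0" "even m"
  shows "card (shifted_evens m 0) = m div 2"
proof -
  have "shifted_evens m 0 = (\<lambda>k. 2 * int k) ` {..<m div 2}"
  proof (intro equalityI subsetI)
    fix x assume "x \<in> shifted_evens m 0"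
    then have "x = 2 * int (nat (x div 2))" "nat (x div 2) < m div 2"
      using assms by (auto simp: shifted_evens_0)
    then show "x \<in> (\<lambda>k. 2 * int k) ` {..<m div 2}" by blast
  qed (use assms in \<open>auto simp: shifted_evens_0\<close>)
  then show ?thesis
    by (simp add: card_image inj_on_def)
qed

text \<open>Parity is thus compatible with addition modulo an even \<open>m\<close>. Both the
  subgroup property of the even residues and the index-two condition rest on this.\<close>

lemma even_mod_even: "even m \<Longrightarrow> even (x mod int m) \<longleftrightarrow> even x"
  by (simp add: dvd_mod_iff)

lemma subgroup_shifted_evens_0:
  assumes "m > 0" "even m"
  shows "subgroup (shifted_evens m 0) (integer_mod_group m)"
proof (rule group.subgroupI)
  show "shifted_evens m 0 \<noteq> {}"
    using assms by (auto simp: shifted_evens_0 intro!: exI[of _ 0])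
qed (use assms in \<open>auto simp: shifted_evens_0 carrier_integer_mod_group even_mod_even\<close>)

section \<open>Instantiation with the even residues and two lines of the field\<close>

theorem theorem3p3:
  fixes F :: "('a, 'b) ring_scheme" and \<gamma> :: 'a and p m i' j' :: nat
  assumes "prime p"
    and "field F" and "order F = p ^ 2"
    and "primitive_element F \<gamma>"
    and "i' \<in> {0..p}" and "j' \<in> {0..p}" and "i' \<noteq> j'"
    and "m > 0" and "even m"
  shows "partial_geometric_difference_set (integer_mod_group m \<times>\<times> add_monoid F)
    (m * p ^ 2) (m * p) ((m div 2) ^ 2 * (p * (p + 3))) ((3 * m ^ 2 * p) div 4)
    ((shifted_evens m 0 \<times> (cyclotomic_class F (p + 1) \<gamma> i' \<union> {\<zero>\<^bsub>F\<^esub>})) \<union>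
     (shifted_evens m 1 \<times> (cyclotomic_class F (p + 1) \<gamma> j' \<union> {\<zero>\<^bsub>F\<^esub>})))"
proof -
  interpret field_of_prime_square_order F p \<gamma>
    using assms by (simp add: field_of_prime_square_order_def field_of_prime_square_order_axioms_def)
  define h where "h = m div 2"
  have m: "m = 2 * h" and "h > 0"
    using assms by (auto simp: h_def)
  let ?Z = "integer_mod_group m" and ?E = "shifted_evens m 0"
  let ?G = "?Z \<times>\<times> add_monoid F" and ?K = "?E \<times> line i'" and ?L = "?E \<times> line j'"
  have E: "subgroup ?E ?Z" and card_E: "card ?E = h"
    using assms subgroup_shifted_evens_0 card_shifted_evens_0 by (simp_all add: h_def)
  have G: "comm_group ?G"
    by (intro comm_group_DirProd abelian_integer_mod_group a_comm_group)
  \<comment> \<open>Two distinct lines span the field, so only the parity of the first coordinate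
    decides membership in the product: it has index two.\<close>
  have KL: "?K <#>\<^bsub>?G\<^esub> ?L = ?E \<times> carrier F"
    using assms(5-7) group.set_mult_subgroup_self[OF group_integer_mod_group E]
    by (simp add: set_mult_DirProd line_add_line)
  have card_K: "card ?K = h * p" "card ?L = h * p" and card_Int: "card (?K \<inter> ?L) = h"
    using assms(5-7) line_Int[of i' j']
    by (auto simp: card_cartesian_product card_line card_E Times_Int_Times)
  interpret pair: subgroup_pair_index_two ?G ?K ?L "(1, \<zero>\<^bsub>F\<^esub>)"
  proof (intro subgroup_pair_index_two.intro G subgroup_pair_index_two_axioms.intro)
    show "finite (carrier ?G)"
      using assms(8) finite_carrier by (simp add: carrier_integer_mod_group)
    show "subgroup ?K ?G" "subgroup ?L ?G"
      by (intro DirProd_subgroups E group_integer_mod_group a_group subgroup_line)+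
    show "card ?L = card ?K"
      by (simp only: card_K)
    \<comment> \<open>The integer 1 would fail to be a reduced residue only for
      \<open>m = 1\<close>, which evenness excludes.\<close>
    show "(1, \<zero>\<^bsub>F\<^esub>) \<in> carrier ?G"
      using \<open>even m\<close> by auto
    show "(1, \<zero>\<^bsub>F\<^esub>) \<notin> ?K <#>\<^bsub>?G\<^esub> ?L"
      unfolding KL using assms by (auto simp: shifted_evens_0)
    show "x \<otimes>\<^bsub>?G\<^esub> y \<in> ?K <#>\<^bsub>?G\<^esub> ?L \<longleftrightarrow> (x \<in> ?K <#>\<^bsub>?G\<^esub> ?L \<longleftrightarrow> y \<in> ?K <#>\<^bsub>?G\<^esub> ?L)"
      if "x \<in> carrier ?G" "y \<in> carrier ?G" for x y
      unfolding KL using that assms(8,9)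
      by (auto simp: shifted_evens_0 carrier_integer_mod_group even_mod_even)
  qed
  have "\<zero>\<^bsub>F\<^esub> <#\<^bsub>add_monoid F\<^esub> line j' = line j'"
    using add.lcos_mult_one[of "line j'"] subgroup.subset[OF subgroup_line] by simp
  then have S: "?K \<union> (shifted_evens m 1 \<times> line j') = ?K \<union> ((1, \<zero>\<^bsub>F\<^esub>) <#\<^bsub>?G\<^esub> ?L)"
    using assms(8,9) by (simp add: shifted_evens_1 l_coset_DirProd)
  have p: "p > 1"
    using assms(1) by (rule prime_gt_1_nat)
  \<comment> \<open>The division is exact because \<open>m = 2 * h\<close>.\<close>
  have \<beta>: "(3 * m\<^sup>2 * p) div 4 = 3 * h\<^sup>2 * p"
    by (simp add: m power_mult_distrib)
  show ?thesis
    unfolding partial_geometric_difference_set_def line_def[symmetric] S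
  proof (intro conjI ballI)
    show "order ?G = m * p\<^sup>2"
      using assms(3,8) by (simp add: order_def card_cartesian_product carrier_integer_mod_group)
    show "m * p < m * p\<^sup>2"
      using p assms(8) by (simp add: power2_eq_square)
    have "m * p \<ge> 2 * 2"
      using p \<open>h > 0\<close> unfolding m by (intro mult_le_mono) auto
    then show "2 < m * p" by simp
    show "card pair.S = m * p"
      unfolding pair.card_S card_K by (simp add: m)
    \<comment> \<open>With \<open>card ?K = h * p\<close> and intersection of size \<open>h\<close>,
      the constant term is \<open>3 * h\<^sup>2 * p\<close>; on the set,
      \<open>h\<^sup>2 * p\<^sup>2\<close> is added, giving
      \<open>h\<^sup>2 * (p * (p + 3))\<close>.\<close>
    show "(\<Sum>y\<in>pair.S. diff_count ?G pair.S (x \<otimes>\<^bsub>?G\<^esub> inv\<^bsub>?G\<^esub> y)) =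
        (if x \<in> pair.S then (m div 2)\<^sup>2 * (p * (p + 3)) else 3 * m\<^sup>2 * p div 4)"
      if "x \<in> carrier ?G" for x
      unfolding pair.sum_diff_count_S[OF that] card_K card_Int \<beta> h_def[symmetric]
      by (simp add: power2_eq_square algebra_simps)
  qed (fact G pair.finite_carrier pair.S_carrier)+
qed

end
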